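(* Let $X_\rho$ be a $\rho$-complete modular space where $\rho$ satisfies the $\Delta_2$-condition, and let $B\subseteq X_\rho$ be a nonempty $\rho$-closed subset of $X_\rho$. Let $T:B\to B$ be a mapping for which there exist real numbers $c,k>0$ with $k\in\,]0,1[$ and $$\rho(c(Tx-Ty))\le k\,\rho(c(x-y))\qquad\text{for all }x,y\in B.$$ Suppose that $\rho(c(x-y))<+\infty$ for all $x,y\in B$. Then $T$ has a unique fixed point.
   Context: A modular on a real or complex vector space $X$ is a functional $\rho:X\to[0,+\infty]$ such that $\rho(x)=0$ if and only if $x=0$; $\rho(\alpha x)=\rho(x)$ for every scalar $\alpha$ with $|\alpha|=1$; and $\rho(\alpha x+\beta y)\le\rho(x)+\rho(y)$ for all $x,y\in X$ and $\alpha,\beta\ge 0$ with $\alpha+\beta=1$. The associated modular space is $X_\rho=\{x\in X:\rho(\lambda x)\to 0\text{ as }\lambda\to 0\}$. A sequence $(x_n)$ in $X_\rho$ is $\rho$-convergent to $x\in X_\rho$ if there exists $c>0$ such that $\rho(c(x_n-x))\to 0$ as $n\to+\infty$. $X_\rho$ is $\rho$-complete if, for every sequence $(x_n)$ in $X_\rho$ and every $c>0$ such that $\rho(c(x_n-x_m))\to 0$ as $n,m\to+\infty$, there exists $x\in X_\rho$ such that $\rho(c(x_n-x))\to 0$ as $n\to+\infty$. A subset $B\subseteq X_\rho$ is $\rho$-closed if the limit of every $\rho$-convergent sequence of elements of $B$ belongs to $B$. The modular $\rho$ satisfies the $\Delta_2$-condition if, for every sequence $(x_n)$ in $X_\rho$,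 $\rho(x_n)\to 0$ implies $\rho(2x_n)\to 0$ as $n\to+\infty$. *)

theory Defs
  imports Complex_Main "HOL-Library.Extended_Nonnegative_Real"
begin

text \<open>
  Real and complex vector spaces are treated at once: the scalars form a
  \<^class>\<open>real_normed_field\<close>. Its instances include \<^typ>\<open>real\<close> and \<^typ>\<open>complex\<close>, and by the
  Gelfand-Mazur theorem every instance is isometrically isomorphic to one of these two.
  Real numbers act as scalars through \<^const>\<open>of_real\<close>.
\<close>

locale modular = vector_space scale
  for scale :: "'k::real_normed_field \<Rightarrow> 'a::ab_group_add \<Rightarrow> 'a" (infixr \<open>*s\<close> 75) +
  fixes \<rho> :: "'a \<Rightarrow> ennreal"
  assumes modular_eq_zero_iff: "\<rho> x = 0 \<longleftrightarrow> x = 0"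
    and modular_unit_scale: "norm a = 1 \<Longrightarrow> \<rho> (a *s x) = \<rho> x"
    and modular_convex_comb:
      "\<lbrakk>0 \<le> \<alpha>; 0 \<le> \<beta>; \<alpha> + \<beta> = 1\<rbrakk>
        \<Longrightarrow> \<rho> (of_real \<alpha> *s x + of_real \<beta> *s y) \<le> \<rho> x + \<rho> y"
begin

definition modular_space :: "'a set"
  where "modular_space = {x. ((\<lambda>l. \<rho> (l *s x)) \<longlongrightarrow> 0) (at 0)}"

definition converges_to :: "(nat \<Rightarrow> 'a) \<Rightarrow> 'a \<Rightarrow> bool"
  where "converges_to u x \<longleftrightarrow>
    (\<exists>c::real. c > 0 \<and> (\<lambda>n. \<rho> (of_real c *s (u n - x))) \<longlonglongrightarrow> 0)"

definition modular_complete :: bool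
  where "modular_complete \<longleftrightarrow>
    (\<forall>u. \<forall>c::real. range u \<subseteq> modular_space \<longrightarrow> c > 0 \<longrightarrow>
      ((\<lambda>(n, m). \<rho> (of_real c *s (u n - u m))) \<longlongrightarrow> 0) (sequentially \<times>\<^sub>F sequentially) \<longrightarrow>
      (\<exists>x\<in>modular_space. (\<lambda>n. \<rho> (of_real c *s (u n - x))) \<longlonglongrightarrow> 0))"

definition modular_closed :: "'a set \<Rightarrow> bool"
  where "modular_closed B \<longleftrightarrow>
    (\<forall>u. \<forall>x\<in>modular_space. range u \<subseteq> B \<longrightarrow> converges_to u x \<longrightarrow> x \<in> B)"

definition Delta2 :: bool
  where "Delta2 \<longleftrightarrow>
    (\<forall>u. range u \<subseteq> modular_space \<longrightarrow> (\<lambda>n. \<rho> (u n)) \<longlonglongrightarrow> 0 \<longrightarrow> (\<lambda>n. \<rho> (2 *s u n)) \<longlonglongrightarrow> 0)"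

end

end

(*
  By the contraction property the orbit x_n of any point of B has d(x_n, x_(n+j)) <= k^n d(x_0, x_j),
  where d(x, y) = rho(c(x - y)), but nothing bounds d(x_0, x_j) uniformly in j, and summing the
  steps d(x_n, x_(n+1)) would lose a factor 2 inside rho each time.  Instead, given e, Delta_2
  yields delta such that d(x, y) <= delta and d(y, z) <= delta imply d(x, z) <= e.  If N satisfies
  k^N e <= delta and n is so large that d(x_n, x_(n+j)) <= delta for all j <= N, then T^N maps the
  e-ball about x_n into itself, so the whole tail of the orbit stays e-close to x_n.
*)

theory Submission
  imports Defs
begin

section \<open>Convergence to zero in the extended nonnegative reals\<close>

lemma tendsto_zero_ennrealI:
  fixes f :: "'b \<Rightarrow> ennreal"
  assumes "\<And>e. 0 < e \<Longrightarrow> eventually (\<lambda>x. f x \<le> ennreal e) F"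
  shows "(f \<longlongrightarrow> 0) F"
proof (rule order_tendstoI)
  fix a :: ennreal
  assume "0 < a"
  \<comment> \<open>An intermediate value is finite even when \<open>a\<close> is infinite, so it is
    a real bound to which the assumption applies.\<close>
  then obtain b where b: "0 < b" "b < a"
    using dense by blast
  then have "b < top"
    using top.not_eq_extremum by fastforce
  then obtain e where e: "b = ennreal e" "0 < e"
    using b(1) by (cases b) auto
  show "eventually (\<lambda>x. f x < a) F"
    using assms[OF e(2)] by eventually_elim (use b e in auto)
qed auto

lemma tendsto_zero_ennreal_le:
  fixes f :: "'b \<Rightarrow> ennreal"
  assumes "(f \<longlongrightarrow> 0) F" "0 < e"
  shows "eventually (\<lambda>x. f x \<le> ennreal e) F"
  using order_tendstoD(2)[OF assms(1), of "ennreal e"] assms(2)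
  by (auto elim: eventually_mono)

text \<open>With \<open>M\<close> finite this is geometric decay in the reals; for
  \<open>0 < k\<close> and infinite \<open>M\<close> every term would be infinite.\<close>

lemma tendsto_power_mult_ennreal_zero:
  fixes M :: ennreal
  assumes "0 \<le> k" "k < 1" "M < \<infinity>"
  shows "(\<lambda>n. ennreal (k ^ n) * M) \<longlonglongrightarrow> 0"
proof -
  obtain m where m: "M = ennreal m" "0 \<le> m"
    using assms(3) by (cases M) auto
  have "(\<lambda>n. k ^ n * m) \<longlonglongrightarrow> 0"
    using assms by (auto intro!: tendsto_mult_left_zero LIMSEQ_power_zero)
  then have "(\<lambda>n. ennreal (k ^ n * m)) \<longlonglongrightarrow> ennreal 0"
    by (rule tendsto_ennrealI)
  then show ?thesis
    using m assms(1) by (simp add: ennreal_mult')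
qed

section \<open>Triangle inequalities and limits in a modular space\<close>

context modular
begin

lemma modular_diff_commute: "\<rho> (a *s (x - y)) = \<rho> (a *s (y - x))"
proof -
  have "a *s (y - x) = (- 1) *s (a *s (x - y))"
    by (simp add: scale_right_diff_distrib)
  then show ?thesis
    using modular_unit_scale[of "- 1"] by simp
qed

text \<open>Convexity with weights 1/2, applied to the doubled vectors, stands in for subadditivity.
  The factor 2 inside \<open>\<rho>\<close> has to be absorbed later, by Delta_2 or by halving the
  scalar.\<close>

lemma modular_add_le: "\<rho> (x + y) \<le> \<rho> (2 *s x) + \<rho> (2 *s y)"
proof -
  have half: "of_real (1 / 2) *s (2 *s z) = z" for z
    by simp
  show ?thesis
    using modular_convex_comb[of "1 / 2" "1 / 2" "2 *s x" "2 *s y"] unfolding half by simp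
qed

lemma modular_triangle:
  "\<rho> (a *s (x - z)) \<le> \<rho> (2 *s a *s (x - y)) + \<rho> (2 *s a *s (y - z))"
  using modular_add_le[of "a *s (x - y)" "a *s (y - z)"]
  by (simp add: scale_right_distrib[symmetric] del: scale_scale)

text \<open>Delta_2 speaks only about \<open>modular_space\<close>, so the scaled differences to
  which it is applied must lie there. The triangle inequality through 0 leaves two terms that vanish
  with \<open>l\<close>.\<close>

lemma scale_diff_mem_modular_space:
  assumes "x \<in> modular_space" "y \<in> modular_space"
  shows "a *s (x - y) \<in> modular_space"
proof (cases "a = 0")
  case True
  then show ?thesis
    using modular_eq_zero_iff[of 0] by (simp add: modular_space_def)
next
  case False
  \<comment> \<open>The filter \<open>at 0\<close> is punctured: the substitution must avoid 0 for
    \<open>l \<noteq> 0\<close>, which is why \<open>a = 0\<close> is treated apart.\<close>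
  have "filterlim (\<lambda>l. 2 * l * a) (at 0) (at (0 :: 'k))"
    unfolding filterlim_at using False
    by (auto intro!: tendsto_eq_intros simp: eventually_at_filter)
  then have lim: "((\<lambda>l. \<rho> ((2 * l * a) *s z)) \<longlongrightarrow> 0) (at 0)" if "z \<in> modular_space" for z
    using that filterlim_compose unfolding modular_space_def by fastforce
  have "\<rho> (l *s a *s (x - y)) \<le> \<rho> ((2 * l * a) *s x) + \<rho> ((2 * l * a) *s y)" for l
    using modular_triangle[of "l * a" x y 0] modular_diff_commute[of "2 * l * a" 0 y]
    by (simp add: mult.assoc)
  moreover have lim_sum: "((\<lambda>l. \<rho> ((2 * l * a) *s x) + \<rho> ((2 * l * a) *s y)) \<longlongrightarrow> 0) (at 0)"
    using tendsto_add[OF lim lim, OF assms] by simp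
  ultimately have "((\<lambda>l. \<rho> (l *s a *s (x - y))) \<longlongrightarrow> 0) (at 0)"
    by (intro tendsto_sandwich[OF _ _ tendsto_const lim_sum]) auto
  then show ?thesis
    by (simp add: modular_space_def)
qed

text \<open>If no \<open>d\<close> worked, counterexamples for \<open>d = 1 / Suc n\<close> would
  form a sequence violating the sequential Delta_2.\<close>

lemma Delta2_uniform:
  assumes Delta2 "0 < e"
  obtains d where "0 < d" "\<And>z. z \<in> modular_space \<Longrightarrow> \<rho> z \<le> ennreal d \<Longrightarrow> \<rho> (2 *s z) \<le> ennreal e"
proof -
  have "\<exists>d>0. \<forall>z\<in>modular_space. \<rho> z \<le> ennreal d \<longrightarrow> \<rho> (2 *s z) \<le> ennreal e"
  proof (rule ccontr)
    assume "\<not> ?thesis"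
    then have "\<forall>n. \<exists>z\<in>modular_space. \<rho> z \<le> ennreal (1 / Suc n) \<and> \<not> \<rho> (2 *s z) \<le> ennreal e"
      by (metis of_nat_0_less_iff zero_less_Suc zero_less_divide_1_iff)
    then obtain u where u: "\<And>n. u n \<in> modular_space" "\<And>n. \<rho> (u n) \<le> ennreal (1 / Suc n)"
      "\<And>n. \<not> \<rho> (2 *s u n) \<le> ennreal e"
      by metis
    have lim: "(\<lambda>n. ennreal (1 / Suc n)) \<longlonglongrightarrow> 0"
      using tendsto_ennrealI[OF LIMSEQ_inverse_real_of_nat] by (simp add: inverse_eq_divide)
    have "(\<lambda>n. \<rho> (u n)) \<longlonglongrightarrow> 0"
      using u(2) by (intro tendsto_sandwich[OF _ _ tendsto_const lim]) auto
    then have "(\<lambda>n. \<rho> (2 *s u n)) \<longlonglongrightarrow> 0"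
      using assms(1) u(1) unfolding Delta2_def by blast
    then show False
      using tendsto_zero_ennreal_le[OF _ assms(2)] u(3) by (force simp: eventually_sequentially)
  qed
  then show thesis
    using that by blast
qed

text \<open>Uniform Delta_2 with tolerance \<open>e / 2\<close> absorbs the factor 2 in each summand
  of \<open>modular_triangle\<close>. Taking a minimum secures \<open>d \<le> e\<close>, on which
  \<open>orbit_tail_close\<close> relies.\<close>

lemma Delta2_triangle:
  assumes Delta2 "0 < e"
  obtains d where "0 < d" "d \<le> e"
    "\<And>x y z. \<lbrakk>x \<in> modular_space; y \<in> modular_space; z \<in> modular_space;
      \<rho> (a *s (x - y)) \<le> ennreal d; \<rho> (a *s (y - z)) \<le> ennreal d\<rbrakk> \<Longrightarrow> \<rho> (a *s (x - z)) \<le> ennreal e"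
proof -
  obtain d where d: "0 < d"
    "\<And>z. z \<in> modular_space \<Longrightarrow> \<rho> z \<le> ennreal d \<Longrightarrow> \<rho> (2 *s z) \<le> ennreal (e / 2)"
    using Delta2_uniform[OF assms(1), of "e / 2"] assms(2) by auto
  show thesis
  proof (rule that[of "min d e"])
    fix x y z
    assume mem: "x \<in> modular_space" "y \<in> modular_space" "z \<in> modular_space"
      and "\<rho> (a *s (x - y)) \<le> ennreal (min d e)" "\<rho> (a *s (y - z)) \<le> ennreal (min d e)"
    then have "\<rho> (a *s (x - y)) \<le> ennreal d" "\<rho> (a *s (y - z)) \<le> ennreal d"
      using ennreal_leI[of "min d e" d] by auto
    then have "\<rho> (a *s (x - z)) \<le> ennreal (e / 2) + ennreal (e / 2)"
      using d(2) mem
      by (intro order_trans[OF modular_triangle[of a x z y]] add_mono)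
        (auto simp: scale_diff_mem_modular_space simp del: scale_scale)
    then show "\<rho> (a *s (x - z)) \<le> ennreal e"
      using assms(2) by (simp flip: ennreal_plus)
  qed (use d assms in auto)
qed

text \<open>At scale \<open>a / 2\<close> the triangle inequality through \<open>u n\<close>
  produces exactly the two given null sequences.\<close>

lemma modular_limit_unique:
  assumes "(\<lambda>n. \<rho> (a *s (u n - x))) \<longlonglongrightarrow> 0" "(\<lambda>n. \<rho> (a *s (u n - y))) \<longlonglongrightarrow> 0" "a \<noteq> 0"
  shows "x = y"
proof -
  have "(\<lambda>n. \<rho> (a *s (u n - x)) + \<rho> (a *s (u n - y))) \<longlonglongrightarrow> 0 + 0"
    using assms by (intro tendsto_add)
  moreover have "\<rho> ((a / 2) *s (x - y)) \<le> \<rho> (a *s (u n - x)) + \<rho> (a *s (u n - y))" for n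
    using modular_triangle[of "a / 2" x y "u n"] modular_diff_commute[of a x "u n"] by simp
  ultimately have "\<rho> ((a / 2) *s (x - y)) \<le> 0"
    by (intro tendsto_lowerbound) auto
  then show ?thesis
    using assms(3) modular_eq_zero_iff[of "(a / 2) *s (x - y)"] by simp
qed

end

section \<open>Orbits and fixed points of a contraction\<close>

locale modular_contraction = modular scale \<rho>
  for scale :: "'k::real_normed_field \<Rightarrow> 'a::ab_group_add \<Rightarrow> 'a" (infixr \<open>*s\<close> 75)
    and \<rho> :: "'a \<Rightarrow> ennreal" +
  fixes B :: "'a set" and T :: "'a \<Rightarrow> 'a" and a :: 'k and k :: real
  assumes subset_modular_space: "B \<subseteq> modular_space"
    and self_map: "x \<in> B \<Longrightarrow> T x \<in> B"
    and k_pos: "0 < k" and k_less_one: "k < 1"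
    and contraction: "\<lbrakk>x \<in> B; y \<in> B\<rbrakk> \<Longrightarrow> \<rho> (a *s (T x - T y)) \<le> ennreal k * \<rho> (a *s (x - y))"
    and finite_dist: "\<lbrakk>x \<in> B; y \<in> B\<rbrakk> \<Longrightarrow> \<rho> (a *s (x - y)) < \<infinity>"
begin

lemma funpow_mem: "x \<in> B \<Longrightarrow> (T ^^ n) x \<in> B"
  by (induction n) (auto simp: self_map)

lemma funpow_contraction:
  assumes "x \<in> B" "y \<in> B"
  shows "\<rho> (a *s ((T ^^ n) x - (T ^^ n) y)) \<le> ennreal (k ^ n) * \<rho> (a *s (x - y))"
proof (induction n)
  case (Suc n)
  have "\<rho> (a *s ((T ^^ Suc n) x - (T ^^ Suc n) y))
      \<le> ennreal k * \<rho> (a *s ((T ^^ n) x - (T ^^ n) y))"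
    using contraction[of "(T ^^ n) x" "(T ^^ n) y"] assms by (simp add: funpow_mem)
  also have "\<dots> \<le> ennreal k * (ennreal (k ^ n) * \<rho> (a *s (x - y)))"
    using Suc.IH by (rule mult_left_mono) simp
  finally show ?case
    using k_pos by (simp add: ennreal_mult mult.assoc)
qed simp

lemma funpow_nonexpansive:
  assumes "x \<in> B" "y \<in> B"
  shows "\<rho> (a *s ((T ^^ n) x - (T ^^ n) y)) \<le> \<rho> (a *s (x - y))"
proof -
  have "ennreal (k ^ n) \<le> ennreal 1"
    using k_pos k_less_one by (intro ennreal_leI power_le_one) auto
  from mult_right_mono[OF this, of "\<rho> (a *s (x - y))"] show ?thesis
    using funpow_contraction[OF assms] by (metis ennreal_1 mult_1 order_trans zero_le)
qed

lemma orbit_tail_close: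
  assumes Delta2 "x \<in> B" "0 < e"
  obtains n where "\<And>j. \<rho> (a *s ((T ^^ n) x - (T ^^ (n + j)) x)) \<le> ennreal e"
proof -
  obtain d where d: "0 < d" "d \<le> e"
    and tri: "\<And>x y z. \<lbrakk>x \<in> modular_space; y \<in> modular_space; z \<in> modular_space;
      \<rho> (a *s (x - y)) \<le> ennreal d; \<rho> (a *s (y - z)) \<le> ennreal d\<rbrakk> \<Longrightarrow> \<rho> (a *s (x - z)) \<le> ennreal e"
    using Delta2_triangle[OF assms(1,3)] by blast
  have mem: "(T ^^ m) x \<in> B" "(T ^^ m) x \<in> modular_space" for m
    using funpow_mem[OF assms(2)] subset_modular_space by auto
  obtain N where N: "k ^ N < d / e"
    using real_arch_pow_inv[of "d / e" k] d assms(3) k_less_one by auto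
  \<comment> \<open>\<open>N = 0\<close> would give \<open>1 < d / e\<close>, against
    \<open>d \<le> e\<close>. The induction on \<open>j\<close> needs \<open>N\<close> positive in
    order to descend.\<close>
  have "N \<noteq> 0"
    using N d assms(3) by (auto intro!: gr0I simp: field_simps)
  have "eventually (\<lambda>n. \<rho> (a *s ((T ^^ n) x - (T ^^ (n + j)) x)) \<le> ennreal d) sequentially" for j
  proof -
    have "(\<lambda>n. ennreal (k ^ n) * \<rho> (a *s (x - (T ^^ j) x))) \<longlonglongrightarrow> 0"
      using k_pos k_less_one finite_dist assms(2) mem
      by (intro tendsto_power_mult_ennreal_zero) auto
    then have "eventually (\<lambda>n. ennreal (k ^ n) * \<rho> (a *s (x - (T ^^ j) x)) \<le> ennreal d) sequentially"
      using d(1) by (rule tendsto_zero_ennreal_le)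
    then show ?thesis
      by eventually_elim
        (use funpow_contraction[OF assms(2) mem(1)] in \<open>auto simp: funpow_add intro: order_trans\<close>)
  qed
  \<comment> \<open>The threshold for \<open>n\<close> depends on \<open>j\<close>; only finitely
    many \<open>j\<close> are involved, so one \<open>n\<close> serves them all.\<close>
  then have "eventually (\<lambda>n. \<forall>j\<in>{..N}. \<rho> (a *s ((T ^^ n) x - (T ^^ (n + j)) x)) \<le> ennreal d) sequentially"
    by (intro eventually_ball_finite) auto
  then obtain n where n: "\<And>j. j \<le> N \<Longrightarrow> \<rho> (a *s ((T ^^ n) x - (T ^^ (n + j)) x)) \<le> ennreal d"
    by (auto simp: eventually_sequentially)
  have "\<rho> (a *s ((T ^^ n) x - (T ^^ (n + j)) x)) \<le> ennreal e" for j
  proof (induction j rule: less_induct)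
    case (less j)
    show ?case
    proof (cases "j \<le> N")
      case True
      then show ?thesis
        using n d(2) by (meson ennreal_leI order_trans)
    next
      case False
      then obtain i where i: "j = N + i"
        by (metis le_add_diff_inverse nat_le_linear)
      \<comment> \<open>\<open>T ^^ N\<close> shrinks the bound \<open>e\<close>, known for
        \<open>i < j\<close> by induction, to at most \<open>d\<close>. The step from
        \<open>n\<close> to \<open>n + N\<close> is also within \<open>d\<close>, so
        \<open>tri\<close> with middle point \<open>(T ^^ (n + N)) x\<close> restores
        \<open>e\<close>.\<close>
      have "\<rho> (a *s ((T ^^ (n + N)) x - (T ^^ (n + j)) x))
          \<le> ennreal (k ^ N) * \<rho> (a *s ((T ^^ n) x - (T ^^ (n + i)) x))"
        using funpow_contraction[OF mem(1) mem(1), of N n "n + i"]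
        by (simp add: i funpow_add[symmetric, THEN fun_cong, unfolded o_apply] ac_simps)
      also have "\<dots> \<le> ennreal (k ^ N) * ennreal e"
        using less i \<open>N \<noteq> 0\<close> by (intro mult_left_mono) auto
      also have "\<dots> = ennreal (k ^ N * e)"
        using k_pos assms(3) by (simp add: ennreal_mult)
      also have "\<dots> \<le> ennreal d"
        using N assms(3) by (intro ennreal_leI) (simp add: field_simps)
      finally show ?thesis
        using tri[OF mem(2) mem(2) mem(2) n] by blast
    qed
  qed
  then show thesis
    using that by blast
qed

lemma orbit_Cauchy:
  assumes Delta2 "x \<in> B"
  shows "((\<lambda>(n, m). \<rho> (a *s ((T ^^ n) x - (T ^^ m) x))) \<longlongrightarrow> 0) (sequentially \<times>\<^sub>F sequentially)"
proof (rule tendsto_zero_ennrealI)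
  fix e :: real
  assume "0 < e"
  then obtain n where n: "\<And>j. \<rho> (a *s ((T ^^ n) x - (T ^^ (n + j)) x)) \<le> ennreal e"
    using orbit_tail_close[OF assms] by blast
  have le: "\<rho> (a *s ((T ^^ p) x - (T ^^ q) x)) \<le> ennreal e" if "n \<le> p" "p \<le> q" for p q
  proof -
    \<comment> \<open>The pair at times \<open>p\<close>, \<open>q\<close> is the image under
      \<open>T ^^ (p - n)\<close> of a pair starting at time \<open>n\<close>, so closeness to
      \<open>(T ^^ n) x\<close> transfers without a further triangle inequality.\<close>
    have "\<rho> (a *s ((T ^^ (p - n + n)) x - (T ^^ (p - n + (n + (q - p)))) x))
        \<le> \<rho> (a *s ((T ^^ n) x - (T ^^ (n + (q - p))) x))"
      unfolding funpow_add[of "p - n"] o_apply by (intro funpow_nonexpansive funpow_mem assms)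
    also note n
    finally show ?thesis
      using that by simp
  qed
  have "\<rho> (a *s ((T ^^ p) x - (T ^^ q) x)) \<le> ennreal e" if "n \<le> p" "n \<le> q" for p q
    using le[of p q] le[of q p] that modular_diff_commute[of a "(T ^^ p) x"] by (cases "p \<le> q") auto
  then show "eventually (\<lambda>pq. (case pq of (p, q) \<Rightarrow> \<rho> (a *s ((T ^^ p) x - (T ^^ q) x))) \<le> ennreal e)
      (sequentially \<times>\<^sub>F sequentially)"
    unfolding eventually_prod_sequentially by auto
qed

text \<open>Iterates leave both points in place, so their distance is bounded by
  \<open>k ^ n\<close> times itself. Its finiteness is essential, since an infinite value would
  satisfy this bound too.\<close>

lemma fixed_point_unique:
  assumes "x \<in> B" "T x = x" "y \<in> B" "T y = y" "a \<noteq> 0"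
  shows "x = y"
proof -
  have "(T ^^ n) x = x" "(T ^^ n) y = y" for n
    using assms by (induction n) auto
  then have "\<rho> (a *s (x - y)) \<le> ennreal (k ^ n) * \<rho> (a *s (x - y))" for n
    using funpow_contraction[OF assms(1,3), of n] by simp
  moreover have "(\<lambda>n. ennreal (k ^ n) * \<rho> (a *s (x - y))) \<longlonglongrightarrow> 0"
    using k_pos k_less_one finite_dist assms by (intro tendsto_power_mult_ennreal_zero) auto
  ultimately have "\<rho> (a *s (x - y)) \<le> 0"
    by (intro tendsto_lowerbound) auto
  then show ?thesis
    using assms(5) modular_eq_zero_iff[of "a *s (x - y)"] by simp
qed

text \<open>The shifted orbit tends to \<open>y\<close> as a tail and to \<open>T y\<close> by
  nonexpansiveness, both at scale \<open>a\<close>.\<close>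

lemma orbit_limit_fixed:
  assumes "x \<in> B" "y \<in> B" "(\<lambda>n. \<rho> (a *s ((T ^^ n) x - y))) \<longlonglongrightarrow> 0" "a \<noteq> 0"
  shows "T y = y"
proof (rule modular_limit_unique)
  show "(\<lambda>n. \<rho> (a *s ((T ^^ Suc n) x - y))) \<longlonglongrightarrow> 0"
    using LIMSEQ_Suc[OF assms(3)] .
  have "\<rho> (a *s ((T ^^ Suc n) x - T y)) \<le> \<rho> (a *s ((T ^^ n) x - y))" for n
    using funpow_nonexpansive[OF funpow_mem[OF assms(1)] assms(2), of 1 n] by simp
  then show "(\<lambda>n. \<rho> (a *s ((T ^^ Suc n) x - T y))) \<longlonglongrightarrow> 0"
    by (intro tendsto_sandwich[OF _ _ tendsto_const assms(3)]) auto
qed (fact assms(4))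

end

theorem theorem2p1:
  fixes scale :: "'k::real_normed_field \<Rightarrow> 'a::ab_group_add \<Rightarrow> 'a"
    and \<rho> :: "'a \<Rightarrow> ennreal"
    and B :: "'a set"
    and T :: "'a \<Rightarrow> 'a"
    and c k :: real
  assumes "modular scale \<rho>"
    and "modular.modular_complete scale \<rho>"
    and "modular.Delta2 scale \<rho>"
    and "B \<subseteq> modular.modular_space scale \<rho>"
    and "B \<noteq> {}"
    and "modular.modular_closed scale \<rho> B"
    and "\<And>x. x \<in> B \<Longrightarrow> T x \<in> B"
    and "c > 0"
    and "0 < k" and "k < 1"
    and "\<And>x y. x \<in> B \<Longrightarrow> y \<in> B \<Longrightarrow>
      \<rho> (scale (of_real c) (T x - T y)) \<le> ennreal k * \<rho> (scale (of_real c) (x - y))"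
    and "\<And>x y. x \<in> B \<Longrightarrow> y \<in> B \<Longrightarrow> \<rho> (scale (of_real c) (x - y)) < \<infinity>"
  shows "\<exists>!x. x \<in> B \<and> T x = x"
proof -
  interpret modular_contraction scale \<rho> B T "of_real c" k
    using assms by (intro modular_contraction.intro modular_contraction_axioms.intro) auto
  obtain x0 where x0: "x0 \<in> B"
    using assms(5) by blast
  then have orbit: "range (\<lambda>n. (T ^^ n) x0) \<subseteq> B"
    using funpow_mem by blast
  \<comment> \<open>Completeness keeps the scale \<open>c\<close> of the Cauchy condition, so the
    limit is taken at the scale where \<open>T\<close> contracts.\<close>
  obtain x where x: "x \<in> modular_space"
    and lim: "(\<lambda>n. \<rho> (scale (of_real c) ((T ^^ n) x0 - x))) \<longlonglongrightarrow> 0"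
    using assms(2)[unfolded modular_complete_def, rule_format, OF _ assms(8) orbit_Cauchy[OF assms(3) x0]]
      orbit subset_modular_space by blast
  have "converges_to (\<lambda>n. (T ^^ n) x0) x"
    unfolding converges_to_def using assms(8) lim by blast
  then have "x \<in> B"
    using assms(6) x orbit unfolding modular_closed_def by blast
  moreover have "T x = x"
    using orbit_limit_fixed[OF x0 \<open>x \<in> B\<close> lim] assms(8) by simp
  ultimately show ?thesis
    using fixed_point_unique assms(8) by (metis less_irrefl of_real_eq_0_iff)
qed

end
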